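(* Let $N\ge 1$, let $G_j\subset\mathbb R^{m_j}$ be bounded domains and $p_j\in G_j$ for $j=1,\ldots,N$. Put $G=G_1\times\cdots\times G_N$, equipped with the Euclidean product norm, and $p=(p_1,\ldots,p_N)$. Let $F=(f_1,\ldots,f_N):\mathbb D\to G$ be harmonic with $F(0)=p$. Then $\|dF_0\|=M_G(p)$ if and only if the following two conditions hold: (1) each component is extremal, that is, $\|d(f_j)_0\|=M_{G_j}(p_j)$ for $j=1,\ldots,N$; (2) the differentials have a common maximizing direction, that is, there is a unit vector $v\in\mathbb R^2$ such that $|d(f_j)_0v|=\|d(f_j)_0\|$ for $j=1,\ldots,N$.
   Context: $\mathbb D=\{z\in\mathbb C:|z|<1\}$. A map $\mathbb D\to\mathbb R^m$ is harmonic if each of its real components is harmonic. For a harmonic map $f:\mathbb D\to\mathbb R^m$, $df_0:\mathbb R^2\to\mathbb R^m$ is its real differential at the origin and $\|df_0\|$ is the operator norm with respect to the Euclidean norms. For a bounded domain $G\subset\mathbb R^m$ and $p\in G$, $$M_G(p)=\sup\{\|df_0\|: f:\mathbb D\to G\ \text{harmonic},\ f(0)=p\}.$$ *)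

theory Defs
  imports "HOL-Analysis.Analysis"
begin

text \<open>The real plane is \<^typ>\<open>complex\<close>, and the unit disc is \<open>ball 0 1\<close> in it.\<close>

definition partial_x :: "(complex \<Rightarrow> real) \<Rightarrow> complex \<Rightarrow> real" where
  "partial_x u z = frechet_derivative u (at z) 1"

definition partial_y :: "(complex \<Rightarrow> real) \<Rightarrow> complex \<Rightarrow> real" where
  "partial_y u z = frechet_derivative u (at z) \<i>"

definition C1_on :: "(complex \<Rightarrow> real) \<Rightarrow> complex set \<Rightarrow> bool" where
  "C1_on u S \<longleftrightarrow> (\<forall>z\<in>S. u differentiable (at z))
     \<and> continuous_on S (partial_x u) \<and> continuous_on S (partial_y u)"

definition C2_on :: "(complex \<Rightarrow> real) \<Rightarrow> complex set \<Rightarrow> bool" where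
  "C2_on u S \<longleftrightarrow> C1_on u S \<and> C1_on (partial_x u) S \<and> C1_on (partial_y u) S"

text \<open>Intended for open \<open>S\<close> only, since the derivatives above are two-sided.\<close>

definition harmonic_on :: "(complex \<Rightarrow> real) \<Rightarrow> complex set \<Rightarrow> bool" where
  "harmonic_on u S \<longleftrightarrow> C2_on u S
     \<and> (\<forall>z\<in>S. partial_x (partial_x u) z + partial_y (partial_y u) z = 0)"

definition harmonic_map :: "(complex \<Rightarrow> 'a::euclidean_space) \<Rightarrow> bool" where
  "harmonic_map f \<longleftrightarrow> (\<forall>b\<in>Basis. harmonic_on (\<lambda>z. f z \<bullet> b) (ball 0 1))"

definition diff0 :: "(complex \<Rightarrow> 'a::euclidean_space) \<Rightarrow> complex \<Rightarrow> 'a" where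
  "diff0 f = frechet_derivative f (at 0)"

text \<open>For bounded \<open>G\<close> and \<open>p \<in> G\<close> the set below is nonempty (constant maps) and bounded
  above (gradient estimate for bounded harmonic functions), so the real-valued \<open>Sup\<close> is the
  true supremum.\<close>

definition M :: "'a::euclidean_space set \<Rightarrow> 'a \<Rightarrow> real" where
  "M G p = Sup {onorm (diff0 f) |f. harmonic_map f \<and> f ` ball 0 1 \<subseteq> G \<and> f 0 = p}"

text \<open>Factors of different dimensions are placed in one ambient type: \<open>\<real>\<^sup>m\<close> is the space of
  vectors supported on a set \<open>K\<close> of \<open>m\<close> coordinates of \<open>real ^ 'k\<close>. As \<open>'k\<close> is arbitrary, every
  choice of finitely many dimensions is covered. The zero coordinates do not affect norms,
  harmonicity, or \<^const>\<open>M\<close>; openness has to be taken relative to the subspace.\<close>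

definition coord_space :: "'k set \<Rightarrow> (real ^ 'k::finite) set" where
  "coord_space K = {x. \<forall>i. i \<notin> K \<longrightarrow> x $ i = 0}"

definition bounded_domain_in :: "'a::euclidean_space set \<Rightarrow> 'a set \<Rightarrow> bool" where
  "bounded_domain_in V G \<longleftrightarrow>
     openin (top_of_set V) G \<and> connected G \<and> bounded G \<and> G \<noteq> {}"

text \<open>The norm of \<open>'a ^ 'n\<close> is the Euclidean product norm.\<close>

definition prod_set :: "('n \<Rightarrow> 'a set) \<Rightarrow> ('a ^ 'n::finite) set" where
  "prod_set G = {x. \<forall>j. x $ j \<in> G j}"

end

theory Submission
  imports Defs "HOL-Complex_Analysis.Cauchy_Integral_Formula"
begin

text \<open>Since \<open>|dF\<^sub>0 v|\<^sup>2 = \<Sum>\<^sub>j |d(f\<^sub>j)\<^sub>0 v|\<^sup>2\<close>, everything follows from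
  \<open>M\<^sub>G(p)\<^sup>2 = \<Sum>\<^sub>j M\<^sub>G\<^sub>j(p\<^sub>j)\<^sup>2\<close>: equality \<open>\<parallel>dF\<^sub>0\<parallel> = M\<^sub>G(p)\<close> forces, at a
  maximizing unit vector \<open>v\<close> of \<open>dF\<^sub>0\<close>, equality in
  \<open>|d(f\<^sub>j)\<^sub>0 v| \<le> \<parallel>d(f\<^sub>j)\<^sub>0\<parallel> \<le> M\<^sub>G\<^sub>j(p\<^sub>j)\<close> for every \<open>j\<close>. The identity holds because precomposing
  the components with independent rotations of the disc aligns their maximizing directions. The
  suprema are finite, and rotations preserve harmonicity, because a harmonic function on the disc is
  the real part of a holomorphic one.\<close>

section \<open>Symmetry of mixed second derivatives\<close>

lemma has_real_derivative_along_line: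
  fixes f :: "'a::real_normed_vector \<Rightarrow> real"
  assumes "f differentiable at (x + s *\<^sub>R d)"
  shows "((\<lambda>t. f (x + t *\<^sub>R d)) has_real_derivative
           frechet_derivative f (at (x + s *\<^sub>R d)) d) (at s)"
proof -
  let ?D = "frechet_derivative f (at (x + s *\<^sub>R d))"
  have D: "(f has_derivative ?D) (at (x + s *\<^sub>R d))"
    using assms by (simp add: frechet_derivative_works)
  have "((\<lambda>t. x + t *\<^sub>R d) has_derivative (\<lambda>t. t *\<^sub>R d)) (at s)"
    by (auto intro!: derivative_eq_intros)
  from has_derivative_compose [OF this D]
  have "((\<lambda>t. f (x + t *\<^sub>R d)) has_derivative (\<lambda>t. ?D (t *\<^sub>R d))) (at s)" .
  moreover have "(\<lambda>t. ?D (t *\<^sub>R d)) = (*) (?D d)"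
    using linear_scale [OF has_derivative_linear [OF D]] by (auto simp: mult.commute)
  ultimately show ?thesis by (simp add: has_field_derivative_def)
qed

text \<open>The mean value theorem is used twice: in direction \<open>d\<close> for
  \<open>s \<mapsto> u (z + h e + s d) - u (z + s d)\<close>, then in direction \<open>e\<close> for
  the derivative of \<open>u\<close> along \<open>d\<close>. The second difference is unchanged when
  \<open>d\<close> and \<open>e\<close> are exchanged, whereas the expression for it is not; this
  asymmetry is exploited below.\<close>

lemma second_difference_mean_value:
  fixes u :: "'a::real_normed_vector \<Rightarrow> real"
  assumes "h > 0"
    and S: "\<And>s t. \<lbrakk>0 \<le> s; s \<le> h; 0 \<le> t; t \<le> h\<rbrakk> \<Longrightarrow> z + s *\<^sub>R d + t *\<^sub>R e \<in> S"
    and u: "\<And>x. x \<in> S \<Longrightarrow> u differentiable at x"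
    and ud: "\<And>x. x \<in> S \<Longrightarrow> (\<lambda>y. frechet_derivative u (at y) d) differentiable at x"
  obtains s t where "0 \<le> s" "s \<le> h" "0 \<le> t" "t \<le> h"
    "u (z + h *\<^sub>R d + h *\<^sub>R e) - u (z + h *\<^sub>R d) - u (z + h *\<^sub>R e) + u z
      = h * (h * frechet_derivative (\<lambda>y. frechet_derivative u (at y) d)
                    (at (z + s *\<^sub>R d + t *\<^sub>R e)) e)"
proof -
  let ?a = "\<lambda>y. frechet_derivative u (at y) d"
  have dg: "((\<lambda>s. u (z + h *\<^sub>R e + s *\<^sub>R d) - u (z + s *\<^sub>R d)) has_real_derivative
      ?a (z + h *\<^sub>R e + s *\<^sub>R d) - ?a (z + s *\<^sub>R d)) (at s)" if "0 \<le> s" "s \<le> h" for s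
    using u[OF S, of s h] u[OF S, of s 0] that \<open>h > 0\<close>
    by (intro DERIV_diff has_real_derivative_along_line) (auto simp: add_ac)
  obtain s where s: "0 < s" "s < h"
    "(u (z + h *\<^sub>R e + h *\<^sub>R d) - u (z + h *\<^sub>R d)) - (u (z + h *\<^sub>R e + 0 *\<^sub>R d) - u (z + 0 *\<^sub>R d))
      = (h - 0) * (?a (z + h *\<^sub>R e + s *\<^sub>R d) - ?a (z + s *\<^sub>R d))"
    using MVT2 [OF \<open>h > 0\<close> dg] by blast
  have da: "((\<lambda>t. ?a (z + s *\<^sub>R d + t *\<^sub>R e)) has_real_derivative
      frechet_derivative ?a (at (z + s *\<^sub>R d + t *\<^sub>R e)) e) (at t)" if "0 \<le> t" "t \<le> h" for t
    using ud[OF S, of s t] that s by (intro has_real_derivative_along_line) auto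
  obtain t where t: "0 < t" "t < h"
    "?a (z + s *\<^sub>R d + h *\<^sub>R e) - ?a (z + s *\<^sub>R d + 0 *\<^sub>R e)
      = (h - 0) * frechet_derivative ?a (at (z + s *\<^sub>R d + t *\<^sub>R e)) e"
    using MVT2 [OF \<open>h > 0\<close> da] by blast
  show thesis
    by (rule that [of s t]) (use s t in \<open>simp_all add: add_ac algebra_simps\<close>)
qed

text \<open>Both mixed derivatives, taken at suitable points near \<open>z\<close>, equal the same
  second difference divided by the square of \<open>h\<close>. Continuity at \<open>z\<close>
  carries this equality over to \<open>z\<close> itself.\<close>

lemma symmetric_second_derivatives:
  fixes u :: "'a::real_normed_vector \<Rightarrow> real"
  defines "D \<equiv> \<lambda>f d x. frechet_derivative f (at x) d"
  assumes "open S" "z \<in> S"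
    and u: "\<And>x. x \<in> S \<Longrightarrow> u differentiable at x"
    and ud: "\<And>x. x \<in> S \<Longrightarrow> D u d differentiable at x"
    and ue: "\<And>x. x \<in> S \<Longrightarrow> D u e differentiable at x"
    and cde: "isCont (D (D u d) e) z" and ced: "isCont (D (D u e) d) z"
  shows "D (D u d) e z = D (D u e) d z"
proof (rule ccontr)
  assume ne: "D (D u d) e z \<noteq> D (D u e) d z"
  \<comment> \<open>Half the supposed gap, so that two errors below \<open>\<epsilon>\<close> cannot
    bridge it.\<close>
  define \<epsilon> where "\<epsilon> = \<bar>D (D u d) e z - D (D u e) d z\<bar> / 2"
  have "\<epsilon> > 0" using ne by (simp add: \<epsilon>_def)
  obtain r0 where r0: "r0 > 0" "ball z r0 \<subseteq> S"
    using \<open>open S\<close> \<open>z \<in> S\<close> open_contains_ball by blast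
  obtain r1 where r1: "r1 > 0" "\<And>x. dist x z < r1 \<Longrightarrow> \<bar>D (D u d) e x - D (D u d) e z\<bar> < \<epsilon>"
    using cde \<open>\<epsilon> > 0\<close> unfolding continuous_at_eps_delta dist_real_def by blast
  obtain r2 where r2: "r2 > 0" "\<And>x. dist x z < r2 \<Longrightarrow> \<bar>D (D u e) d x - D (D u e) d z\<bar> < \<epsilon>"
    using ced \<open>\<epsilon> > 0\<close> unfolding continuous_at_eps_delta dist_real_def by blast
  define r where "r = min r0 (min r1 r2)"
  \<comment> \<open>Small enough that the whole parallelogram spanned by \<open>h d\<close> and
    \<open>h e\<close> at \<open>z\<close> lies within distance \<open>r\<close>; the summand 1
    keeps the denominator positive and the estimate strict.\<close>
  define h where "h = r / (norm d + norm e + 1)"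
  have "r > 0" using r0 r1 r2 by (simp add: r_def)
  then have "h > 0" by (simp add: h_def add_nonneg_pos)
  have near: "dist (z + s *\<^sub>R d + t *\<^sub>R e) z < r" if "0 \<le> s" "s \<le> h" "0 \<le> t" "t \<le> h" for s t
  proof -
    have "dist (z + s *\<^sub>R d + t *\<^sub>R e) z \<le> s * norm d + t * norm e"
      using norm_triangle_ineq[of "s *\<^sub>R d" "t *\<^sub>R e"] that by (simp add: dist_norm add.assoc)
    also have "\<dots> \<le> h * norm d + h * norm e"
      using that by (intro add_mono mult_right_mono) auto
    also have "\<dots> < h * (norm d + norm e + 1)"
      using \<open>h > 0\<close> by (simp add: algebra_simps)
    also have "\<dots> = r"
      using add_nonneg_pos[of "norm d + norm e" 1] by (simp add: h_def)
    finally show ?thesis .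
  qed
  have inS: "z + s *\<^sub>R d + t *\<^sub>R e \<in> S" if "0 \<le> s" "s \<le> h" "0 \<le> t" "t \<le> h" for s t
    using near[OF that] r0 by (auto simp: r_def dist_commute)
  obtain s t where st: "0 \<le> s" "s \<le> h" "0 \<le> t" "t \<le> h"
    "u (z + h *\<^sub>R d + h *\<^sub>R e) - u (z + h *\<^sub>R d) - u (z + h *\<^sub>R e) + u z
      = h * (h * D (D u d) e (z + s *\<^sub>R d + t *\<^sub>R e))"
    using second_difference_mean_value[OF \<open>h > 0\<close> inS u ud[unfolded D_def]] unfolding D_def by blast
  \<comment> \<open>The same parallelogram with the roles of \<open>d\<close> and \<open>e\<close>
    exchanged.\<close>
  have inS': "z + s *\<^sub>R e + t *\<^sub>R d \<in> S" if "0 \<le> s" "s \<le> h" "0 \<le> t" "t \<le> h" for s t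
    using inS[of t s] that by (simp add: add_ac)
  obtain s' t' where st': "0 \<le> s'" "s' \<le> h" "0 \<le> t'" "t' \<le> h"
    "u (z + h *\<^sub>R e + h *\<^sub>R d) - u (z + h *\<^sub>R e) - u (z + h *\<^sub>R d) + u z
      = h * (h * D (D u e) d (z + s' *\<^sub>R e + t' *\<^sub>R d))"
    using second_difference_mean_value[OF \<open>h > 0\<close> inS' u ue[unfolded D_def]] unfolding D_def by blast
  have swap: "z + h *\<^sub>R e + h *\<^sub>R d = z + h *\<^sub>R d + h *\<^sub>R e"
    "z + s' *\<^sub>R e + t' *\<^sub>R d = z + t' *\<^sub>R d + s' *\<^sub>R e"
    by simp_all
  have "h * (h * D (D u d) e (z + s *\<^sub>R d + t *\<^sub>R e)) = h * (h * D (D u e) d (z + t' *\<^sub>R d + s' *\<^sub>R e))"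
    using st(5) st'(5)[unfolded swap] by linarith
  then have "D (D u d) e (z + s *\<^sub>R d + t *\<^sub>R e) = D (D u e) d (z + t' *\<^sub>R d + s' *\<^sub>R e)"
    using \<open>h > 0\<close> by simp
  moreover have "\<bar>D (D u d) e (z + s *\<^sub>R d + t *\<^sub>R e) - D (D u d) e z\<bar> < \<epsilon>"
    using near[OF st(1-4)] r1 by (simp add: r_def)
  moreover have "\<bar>D (D u e) d (z + t' *\<^sub>R d + s' *\<^sub>R e) - D (D u e) d z\<bar> < \<epsilon>"
    using near[OF st'(3,4,1,2)] r2 by (simp add: r_def)
  ultimately have "\<bar>D (D u d) e z - D (D u e) d z\<bar> < \<epsilon> + \<epsilon>"
    by linarith
  then show False by (simp add: \<epsilon>_def)
qed

section \<open>Harmonic functions as real parts of holomorphic functions\<close>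

lemma partial_cong:
  assumes "open S" "\<And>z. z \<in> S \<Longrightarrow> u z = v z" "z \<in> S"
  shows "partial_x u z = partial_x v z" "partial_y u z = partial_y v z"
proof -
  \<comment> \<open>Differentiability is not assumed: \<open>frechet_derivative\<close> chooses
    among all derivatives, so it is enough that \<open>u\<close> and \<open>v\<close> have the same
    ones.\<close>
  have "(u has_derivative D) (at z) \<longleftrightarrow> (v has_derivative D) (at z)" for D
    using has_derivative_transform_within_open[OF _ assms(1,3), of u D UNIV v]
      has_derivative_transform_within_open[OF _ assms(1,3), of v D UNIV u] assms(2) by auto
  then show "partial_x u z = partial_x v z" "partial_y u z = partial_y v z"
    by (simp_all add: partial_x_def partial_y_def frechet_derivative_def)
qed

lemma C1_on_cong:
  assumes "open S" "\<And>z. z \<in> S \<Longrightarrow> u z = v z" "C1_on u S"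
  shows "C1_on v S"
proof -
  have "v differentiable at z" if "z \<in> S" for z
    using assms that unfolding C1_on_def differentiable_def
    by (metis has_derivative_transform_within_open)
  then show ?thesis
    using assms(3) partial_cong[OF assms(1,2)] unfolding C1_on_def
    by (auto cong: continuous_on_cong)
qed

lemma partial_Re:
  assumes "(h has_field_derivative h') (at z)"
  shows "((\<lambda>w. Re (h w)) has_derivative (\<lambda>w. Re (h' * w))) (at z)"
    "partial_x (\<lambda>w. Re (h w)) z = Re h'" "partial_y (\<lambda>w. Re (h w)) z = - Im h'"
proof -
  show D: "((\<lambda>w. Re (h w)) has_derivative (\<lambda>w. Re (h' * w))) (at z)"
    using assms unfolding has_field_derivative_def by (intro has_derivative_Re)
  show "partial_x (\<lambda>w. Re (h w)) z = Re h'" "partial_y (\<lambda>w. Re (h w)) z = - Im h'"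
    by (simp_all add: partial_x_def partial_y_def frechet_derivative_at[OF D, symmetric])
qed

lemma C1_on_Re:
  assumes "open S" "h holomorphic_on S"
  shows "C1_on (\<lambda>z. Re (h z)) S"
proof -
  have h: "(h has_field_derivative deriv h z) (at z)" if "z \<in> S" for z
    using assms that by (simp add: holomorphic_derivI)
  have "continuous_on S (deriv h)"
    using assms by (intro holomorphic_on_imp_continuous_on holomorphic_deriv)
  then have "continuous_on S (\<lambda>z. Re (deriv h z))" "continuous_on S (\<lambda>z. - Im (deriv h z))"
    by (auto intro!: continuous_intros)
  then show ?thesis
    using partial_Re[OF h] unfolding C1_on_def differentiable_def
    by (auto cong: continuous_on_cong)
qed

text \<open>The first partials of \<open>Re h\<close> are \<open>Re h'\<close> and
  \<open>Re (\<i> h')\<close>, again real parts of holomorphic functions, so \<open>C1_on_Re\<close>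
  also covers the second order. The pure second partials are \<open>Re h''\<close> and
  \<open>- Re h''\<close>, which cancel.\<close>

lemma harmonic_on_Re:
  assumes "open S" "h holomorphic_on S" "\<And>z. z \<in> S \<Longrightarrow> u z = Re (h z)"
  shows "harmonic_on u S"
proof -
  have h: "(h has_field_derivative deriv h z) (at z)" if "z \<in> S" for z
    using assms that by (simp add: holomorphic_derivI)
  have hol: "deriv h holomorphic_on S" "(\<lambda>z. \<i> * deriv h z) holomorphic_on S"
    using assms by (auto intro!: holomorphic_intros)
  have h': "(deriv h has_field_derivative deriv (deriv h) z) (at z)" if "z \<in> S" for z
    using hol(1) assms(1) that by (simp add: holomorphic_derivI)
  have h'': "((\<lambda>z. \<i> * deriv h z) has_field_derivative \<i> * deriv (deriv h) z) (at z)" if "z \<in> S" for z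
    using h'[OF that] by (rule DERIV_cmult)
  have u: "partial_x u z = Re (deriv h z)" "partial_y u z = Re (\<i> * deriv h z)" if "z \<in> S" for z
    using partial_cong[OF assms(1,3) that] partial_Re[OF h[OF that]] by simp_all
  have "C1_on u S"
    using C1_on_cong[OF assms(1) _ C1_on_Re[OF assms(1,2)]] assms(3) by simp
  moreover have "C1_on (partial_x u) S" "C1_on (partial_y u) S"
    using C1_on_cong[OF assms(1) _ C1_on_Re[OF assms(1) hol(1)]]
      C1_on_cong[OF assms(1) _ C1_on_Re[OF assms(1) hol(2)]] u by simp_all
  moreover have "partial_x (partial_x u) z + partial_y (partial_y u) z = 0" if "z \<in> S" for z
    using partial_cong(1)[OF assms(1) u(1) that] partial_cong(2)[OF assms(1) u(2) that]
      partial_Re(2)[OF h'[OF that]] partial_Re(3)[OF h''[OF that]] by simp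
  ultimately show ?thesis by (simp add: harmonic_on_def C2_on_def)
qed

text \<open>The function \<open>g = u_x - \<i> u_y\<close> is holomorphic: its Cauchy-Riemann
  equations are Laplace's equation and the symmetry of the mixed derivatives. On a convex set
  \<open>g\<close> has a primitive, whose real part has the same differential as
  \<open>u\<close>.\<close>

lemma harmonic_on_imp_Re_holomorphic:
  assumes "harmonic_on u S" "open S" "convex S"
  obtains h where "h holomorphic_on S" "\<And>z. z \<in> S \<Longrightarrow> u z = Re (h z)"
proof (cases "S = {}")
  case True
  then show thesis by (intro that[of "\<lambda>_. 0"]) simp_all
next
  case False
  then obtain a where "a \<in> S" by blast
  have C2: "C1_on u S" "C1_on (partial_x u) S" "C1_on (partial_y u) S"
    and lap: "\<And>z. z \<in> S \<Longrightarrow> partial_x (partial_x u) z + partial_y (partial_y u) z = 0"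
    using assms(1) by (auto simp: harmonic_on_def C2_on_def)
  define D where "D f (d::complex) x = frechet_derivative f (at x) d"
    for f :: "complex \<Rightarrow> real" and d x
  have px: "partial_x f = D f 1" and py: "partial_y f = D f \<i>" for f
    by (simp_all add: fun_eq_iff partial_x_def partial_y_def D_def)
  have expand: "frechet_derivative f (at z) w = Re w * partial_x f z + Im w * partial_y f z"
    if "f differentiable at z" for f :: "complex \<Rightarrow> real" and z w
  proof -
    have "linear (frechet_derivative f (at z))"
      using that by (simp add: linear_frechet_derivative)
    then have "frechet_derivative f (at z) (Re w *\<^sub>R 1 + Im w *\<^sub>R \<i>) =
        Re w * partial_x f z + Im w * partial_y f z"
      by (simp add: linear_add linear_scale partial_x_def partial_y_def)
    then show ?thesis by (simp add: complex_eq[symmetric] scaleR_conv_of_real mult.commute)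
  qed
  have symm: "partial_y (partial_x u) z = partial_x (partial_y u) z" if "z \<in> S" for z
    using C2 that unfolding C1_on_def px py D_def
    by (intro symmetric_second_derivatives[OF \<open>open S\<close> that])
       (auto simp: continuous_on_eq_continuous_at[OF \<open>open S\<close>])
  define g where "g z = Complex (partial_x u z) (- partial_y u z)" for z
  have g: "(g has_field_derivative
      Complex (partial_x (partial_x u) z) (- partial_x (partial_y u) z)) (at z)" if "z \<in> S" for z
  proof -
    have d: "partial_x u differentiable at z" "partial_y u differentiable at z"
      using C2 that by (auto simp: C1_on_def)
    then have "(partial_x u has_derivative (\<lambda>w. frechet_derivative (partial_x u) (at z) w)) (at z)"
      "(partial_y u has_derivative (\<lambda>w. frechet_derivative (partial_y u) (at z) w)) (at z)"
      by (simp_all add: frechet_derivative_works)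
    then have "(g has_derivative (\<lambda>w. complex_of_real (frechet_derivative (partial_x u) (at z) w)
        + \<i> * complex_of_real (- frechet_derivative (partial_y u) (at z) w))) (at z)"
      unfolding g_def Complex_eq by (auto intro!: derivative_eq_intros)
    \<comment> \<open>The real differential of \<open>g\<close> is complex linear: by
      \<open>u_yy = - u_xx\<close> and \<open>u_xy = u_yx\<close> it is multiplication by
      \<open>u_xx - \<i> u_xy\<close>.\<close>
    moreover have "(\<lambda>w. complex_of_real (frechet_derivative (partial_x u) (at z) w)
        + \<i> * complex_of_real (- frechet_derivative (partial_y u) (at z) w))
      = (*) (Complex (partial_x (partial_x u) z) (- partial_x (partial_y u) z))"
    proof
      fix w
      have "partial_y (partial_y u) z = - partial_x (partial_x u) z"
        using lap[OF that] by linarith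
      then show "complex_of_real (frechet_derivative (partial_x u) (at z) w)
        + \<i> * complex_of_real (- frechet_derivative (partial_y u) (at z) w)
        = Complex (partial_x (partial_x u) z) (- partial_x (partial_y u) z) * w"
        using d symm[OF that] by (simp add: expand complex_eq_iff algebra_simps)
    qed
    ultimately show ?thesis by (simp add: has_field_derivative_def)
  qed
  then have "g holomorphic_on S"
    using \<open>open S\<close> holomorphic_on_open by blast
  then obtain h where "\<And>z. z \<in> S \<Longrightarrow> (h has_field_derivative g z) (at z within S)"
    using holomorphic_convex_primitive'[OF assms(3,2)] by blast
  then have h: "\<And>z. z \<in> S \<Longrightarrow> (h has_field_derivative g z) (at z)"
    using \<open>open S\<close> by (metis at_within_open)
  \<comment> \<open>Since \<open>Re ((u_x - \<i> u_y) w) = u_x Re w + u_y Im w\<close>, the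
    differentials of \<open>u\<close> and \<open>Re h\<close> cancel.\<close>
  have "((\<lambda>w. u w - Re (h w)) has_derivative (\<lambda>w. 0)) (at z within S)" if "z \<in> S" for z
  proof -
    have "u differentiable at z" using C2 that by (auto simp: C1_on_def)
    then have "(u has_derivative (\<lambda>w. Re w * partial_x u z + Im w * partial_y u z)) (at z)"
      using expand frechet_derivative_works by (metis (no_types, lifting) ext)
    from has_derivative_diff[OF this partial_Re(1)[OF h[OF that]]]
    have "((\<lambda>w. u w - Re (h w)) has_derivative (\<lambda>w. 0)) (at z)"
      by (simp add: g_def mult.commute)
    then show ?thesis by (rule has_derivative_at_withinI)
  qed
  from has_derivative_zero_constant[OF \<open>convex S\<close> this]
  obtain c where c: "\<And>z. z \<in> S \<Longrightarrow> u z - Re (h z) = c" by auto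
  show thesis
  proof (rule that)
    show "(\<lambda>z. h z + of_real c) holomorphic_on S"
      using h \<open>open S\<close> by (intro holomorphic_intros) (auto simp: holomorphic_on_open)
    show "u z = Re (h z + of_real c)" if "z \<in> S" for z
      using c[OF that] by simp
  qed
qed

section \<open>Rotation invariance and a gradient bound for harmonic functions\<close>

lemma harmonic_on_rotate:
  assumes "harmonic_on u (ball 0 1)" "cmod c = 1"
  shows "harmonic_on (\<lambda>z. u (c * z)) (ball 0 1)"
proof -
  \<comment> \<open>Passing to a holomorphic \<open>h\<close> replaces a second-order chain rule by
    composition of holomorphic functions.\<close>
  obtain h where h: "h holomorphic_on ball 0 1" "\<And>z. z \<in> ball 0 1 \<Longrightarrow> u z = Re (h z)"
    using harmonic_on_imp_Re_holomorphic[OF assms(1)] by auto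
  have im: "(\<lambda>z. c * z) ` ball 0 1 \<subseteq> ball 0 1"
    using assms(2) by (auto simp: norm_mult)
  have "(h \<circ> (\<lambda>z. c * z)) holomorphic_on ball 0 1"
    using h(1) im by (intro holomorphic_on_compose_gen[of _ _ h "ball 0 1"] holomorphic_intros)
  then have "(\<lambda>z. h (c * z)) holomorphic_on ball 0 1"
    by (simp add: o_def)
  then show ?thesis
    using h(2) im by (intro harmonic_on_Re) (auto simp: image_subset_iff)
qed

text \<open>If \<open>u = Re h\<close> then \<open>exp \<circ> h\<close> is a bounded holomorphic function with derivative
  \<open>h' exp h\<close>, so Cauchy's inequality applies to it.\<close>

lemma harmonic_gradient_bound:
  assumes "harmonic_on u (ball 0 1)" "\<And>z. z \<in> ball 0 1 \<Longrightarrow> \<bar>u z\<bar> \<le> B"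
  shows "\<bar>frechet_derivative u (at 0) w\<bar> \<le> 2 * exp (2 * B) * cmod w"
proof -
  obtain h where h: "h holomorphic_on ball 0 1" "\<And>z. z \<in> ball 0 1 \<Longrightarrow> u z = Re (h z)"
    using harmonic_on_imp_Re_holomorphic[OF assms(1)] by auto
  have dh: "(h has_field_derivative deriv h 0) (at 0)"
    using h(1) by (simp add: holomorphic_derivI)
  have "((\<lambda>z. Re (h z)) has_derivative (\<lambda>w. Re (deriv h 0 * w))) (at 0)"
    by (rule partial_Re(1)[OF dh])
  then have "(u has_derivative (\<lambda>w. Re (deriv h 0 * w))) (at 0)"
    by (rule has_derivative_transform_within_open[of _ _ _ _ "ball 0 1"]) (auto simp: h(2))
  then have fd: "frechet_derivative u (at 0) w = Re (deriv h 0 * w)"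
    by (simp add: frechet_derivative_at[symmetric])
  \<comment> \<open>The radius \<open>1/2\<close> keeps the closed disc inside the domain of
    \<open>h\<close>; on its boundary \<open>|exp h| = exp u \<le> exp B\<close>.\<close>
  have "cmod ((deriv ^^ 1) (\<lambda>z. exp (h z)) 0) \<le> fact 1 * exp B / (1/2) ^ 1"
  proof (rule Cauchy_inequality)
    show "(\<lambda>z. exp (h z)) holomorphic_on ball 0 (1/2)"
      using h(1) by (intro holomorphic_intros) (auto elim: holomorphic_on_subset)
    show "continuous_on (cball 0 (1/2)) (\<lambda>z. exp (h z))"
      using holomorphic_on_imp_continuous_on[OF h(1)]
      by (intro continuous_intros) (auto elim!: continuous_on_subset)
    show "cmod (exp (h z)) \<le> exp B" if "cmod (0 - z) = 1/2" for z
      using assms(2)[of z] h(2)[of z] that by auto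
  qed simp
  moreover have "deriv (\<lambda>z. exp (h z)) 0 = exp (h 0) * deriv h 0"
    using dh by (intro DERIV_imp_deriv) (auto intro!: derivative_eq_intros)
  ultimately have "exp (u 0) * cmod (deriv h 0) \<le> 2 * exp B"
    using h(2)[of 0] by (simp add: norm_mult)
  \<comment> \<open>The factor \<open>exp (u 0)\<close> is at least \<open>exp (- B)\<close>, which
    removes the dependence on \<open>u 0\<close>. A bound in terms of \<open>B\<close> alone is all
    that finiteness of \<open>M\<close> requires.\<close>
  moreover have "exp (- B) * cmod (deriv h 0) \<le> exp (u 0) * cmod (deriv h 0)"
    using assms(2)[of 0] by (intro mult_right_mono) auto
  ultimately have "exp B * (exp (- B) * cmod (deriv h 0)) \<le> exp B * (2 * exp B)"
    by (intro mult_left_mono) auto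
  moreover have "exp B * (exp (- B) * cmod (deriv h 0)) = cmod (deriv h 0)"
    by (simp add: exp_minus)
  moreover have "exp B * (2 * exp B) = 2 * exp (2 * B)"
    by (simp add: exp_double power2_eq_square)
  ultimately have "cmod (deriv h 0) \<le> 2 * exp (2 * B)" by simp
  then have "cmod (deriv h 0 * w) \<le> 2 * exp (2 * B) * cmod w"
    by (simp add: norm_mult mult_right_mono)
  then show ?thesis
    using abs_Re_le_cmod[of "deriv h 0 * w"] fd by linarith
qed

section \<open>Competitors of the extremal problem and finiteness of \<open>M\<close>\<close>

definition admissible :: "'a::euclidean_space set \<Rightarrow> 'a \<Rightarrow> (complex \<Rightarrow> 'a) \<Rightarrow> bool" where
  "admissible G p f \<longleftrightarrow> harmonic_map f \<and> f ` ball 0 1 \<subseteq> G \<and> f 0 = p"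

lemma M_eq_Sup: "M G p = (SUP f\<in>Collect (admissible G p). onorm (diff0 f))"
  unfolding M_def admissible_def by (rule arg_cong[of _ _ Sup]) auto

lemma harmonic_map_has_derivative:
  fixes f :: "complex \<Rightarrow> 'a::euclidean_space"
  assumes "harmonic_map f"
  shows "(f has_derivative diff0 f) (at 0)"
proof -
  have "(\<lambda>z. f z \<bullet> b) differentiable at 0" if "b \<in> Basis" for b
    using assms that unfolding harmonic_map_def harmonic_on_def C2_on_def C1_on_def by simp
  then have "f differentiable at 0"
    using differentiable_componentwise_within by blast
  then show ?thesis
    by (simp add: diff0_def frechet_derivative_works)
qed

text \<open>Every coordinate of a competitor is a harmonic function bounded by the same
  \<open>B\<close>, so the gradient bound is uniform over competitors; summing over the basis costs
  the factor \<open>DIM('a)\<close>. This makes the real \<open>Sup\<close> in \<open>M\<close> an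
  actual upper bound.\<close>

lemma bdd_above_onorm_diff0:
  fixes G :: "'a::euclidean_space set"
  assumes "bounded G"
  shows "bdd_above ((\<lambda>f. onorm (diff0 f)) ` Collect (admissible G p))"
proof -
  obtain B where B: "\<And>x. x \<in> G \<Longrightarrow> norm x \<le> B"
    using assms bounded_iff by metis
  have "onorm (diff0 f) \<le> DIM('a) * (2 * exp (2 * B))" if "admissible G p f" for f
  proof (rule onorm_bound)
    fix w
    have D: "(f has_derivative diff0 f) (at 0)"
      using that by (simp add: admissible_def harmonic_map_has_derivative)
    have "\<bar>diff0 f w \<bullet> b\<bar> \<le> 2 * exp (2 * B) * cmod w" if b: "b \<in> Basis" for b
    proof -
      have "((\<lambda>z. f z \<bullet> b) has_derivative (\<lambda>w. diff0 f w \<bullet> b)) (at 0)"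
        by (rule has_derivative_inner_left[OF D])
      then have "frechet_derivative (\<lambda>z. f z \<bullet> b) (at 0) w = diff0 f w \<bullet> b"
        by (simp add: frechet_derivative_at[symmetric])
      moreover have "\<bar>f z \<bullet> b\<bar> \<le> B" if "z \<in> ball 0 1" for z
        using B[of "f z"] \<open>admissible G p f\<close> that Basis_le_norm[OF b, of "f z"]
        by (force simp: admissible_def)
      moreover have "harmonic_on (\<lambda>z. f z \<bullet> b) (ball 0 1)"
        using \<open>admissible G p f\<close> b by (simp add: admissible_def harmonic_map_def)
      ultimately show ?thesis
        using harmonic_gradient_bound by metis
    qed
    then have "(\<Sum>b\<in>Basis. \<bar>diff0 f w \<bullet> b\<bar>) \<le> (\<Sum>b\<in>(Basis::'a set). 2 * exp (2 * B) * cmod w)"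
      by (rule sum_mono)
    then show "norm (diff0 f w) \<le> DIM('a) * (2 * exp (2 * B)) * norm w"
      using norm_le_l1[of "diff0 f w"] by simp
  qed simp
  then show ?thesis by (intro bdd_aboveI2) auto
qed

lemma onorm_diff0_le_M:
  assumes "bounded G" "admissible G p f"
  shows "onorm (diff0 f) \<le> M G p"
  unfolding M_eq_Sup using assms by (intro cSUP_upper bdd_above_onorm_diff0) auto

text \<open>Compactness of the unit circle. The attaining vector is what allows an operator norm to
  be split into the contributions of the components.\<close>

lemma onorm_attained:
  fixes L :: "complex \<Rightarrow> 'a::real_normed_vector"
  assumes "bounded_linear L"
  obtains v where "norm v = 1" "norm (L v) = onorm L"
proof -
  interpret L: bounded_linear L by fact
  have "continuous_on (sphere 0 1) (\<lambda>w. norm (L w))"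
    by (intro continuous_on_norm L.continuous_on continuous_on_id)
  then obtain v where v: "v \<in> sphere 0 1" "\<And>w. w \<in> sphere 0 1 \<Longrightarrow> norm (L w) \<le> norm (L v)"
    using continuous_attains_sup[of "sphere 0 1" "\<lambda>w. norm (L w)"]
    by auto
  have "norm (L x) \<le> norm (L v) * norm x" for x
  proof (cases "x = 0")
    case False
    then have "norm (L (x /\<^sub>R norm x)) \<le> norm (L v)"
      by (intro v(2)) simp
    then show ?thesis using False by (simp add: L.scaleR field_simps)
  qed (simp add: L.zero)
  then have "onorm L \<le> norm (L v)" by (intro onorm_bound) auto
  moreover have "norm (L v) \<le> onorm L" using onorm[OF assms, of v] v(1) by simp
  ultimately show thesis using v(1) by (intro that[of v]) auto
qed

text \<open>At \<open>w = 1\<close> the rotated map has differential \<open>diff0 f c\<close>, so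
  any unit maximizing direction \<open>c\<close> can be moved to 1 without leaving the class of
  competitors.\<close>

lemma admissible_rotate:
  assumes "admissible G p f" "cmod c = 1"
  shows "admissible G p (\<lambda>z. f (c * z))" "diff0 (\<lambda>z. f (c * z)) w = diff0 f (c * w)"
proof -
  have "c * z \<in> ball 0 1" if "z \<in> ball 0 1" for z
    using that assms(2) by (simp add: norm_mult)
  then show "admissible G p (\<lambda>z. f (c * z))"
    using assms harmonic_on_rotate[OF _ assms(2)]
    by (auto simp: admissible_def harmonic_map_def image_subset_iff)
  have "((\<lambda>z. c * z) has_derivative (\<lambda>w. c * w)) (at 0)"
    by (auto intro!: derivative_eq_intros)
  moreover have "(f has_derivative diff0 f) (at (c * 0))"
    using assms by (simp add: admissible_def harmonic_map_has_derivative)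
  ultimately have "((\<lambda>z. f (c * z)) has_derivative (\<lambda>w. diff0 f (c * w))) (at 0)"
    by (rule has_derivative_compose)
  then show "diff0 (\<lambda>z. f (c * z)) w = diff0 f (c * w)"
    by (simp add: diff0_def[of "\<lambda>z. f (c * z)"] frechet_derivative_at[symmetric])
qed

section \<open>Maps into a product and the Pythagorean identity for \<open>M\<close>\<close>

lemma harmonic_map_vec:
  fixes F :: "complex \<Rightarrow> 'a::euclidean_space ^ 'n::finite"
  shows "harmonic_map F \<longleftrightarrow> (\<forall>j. harmonic_map (\<lambda>z. F z $ j))"
  \<comment> \<open>The basis vectors of the product are \<open>axis j b\<close>, so the coordinates
    of \<open>F\<close> are exactly the coordinates of its components.\<close>
  by (auto simp: harmonic_map_def Basis_vec_def inner_axis)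

lemma admissible_prod_set:
  fixes F :: "complex \<Rightarrow> 'a::euclidean_space ^ 'n::finite"
  shows "admissible (prod_set G) p F \<longleftrightarrow> (\<forall>j. admissible (G j) (p $ j) (\<lambda>z. F z $ j))"
  unfolding admissible_def harmonic_map_vec[of F] by (auto simp: prod_set_def vec_eq_iff)

lemma diff0_nth:
  fixes F :: "complex \<Rightarrow> 'a::euclidean_space ^ 'n::finite"
  assumes "harmonic_map F"
  shows "diff0 F w $ j = diff0 (\<lambda>z. F z $ j) w"
proof -
  have "((\<lambda>z. F z $ j) has_derivative (\<lambda>w. diff0 F w $ j)) (at 0)"
    using bounded_linear.has_derivative[OF bounded_linear_vec_nth harmonic_map_has_derivative[OF assms]] .
  then show ?thesis by (simp add: diff0_def[of "\<lambda>z. F z $ j"] frechet_derivative_at[symmetric])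
qed

lemma power2_norm_vec: "(norm x)\<^sup>2 = (\<Sum>j\<in>UNIV. (norm (x $ j))\<^sup>2)"
  by (simp add: norm_vec_def L2_set_def sum_nonneg)

lemma bounded_prod_set:
  fixes G :: "'n::finite \<Rightarrow> 'a::real_normed_vector set"
  assumes "\<And>j. bounded (G j)"
  shows "bounded (prod_set G)"
proof -
  obtain B where B: "\<And>j x. x \<in> G j \<Longrightarrow> norm x \<le> B j"
    using assms unfolding bounded_iff by metis
  have "norm x \<le> (\<Sum>j\<in>UNIV. B j)" if "x \<in> prod_set G" for x
  proof -
    have "norm x \<le> (\<Sum>j\<in>UNIV. norm (x $ j))"
      unfolding norm_vec_def by (rule L2_set_le_sum) simp
    also have "\<dots> \<le> (\<Sum>j\<in>UNIV. B j)"
      using that B by (intro sum_mono) (auto simp: prod_set_def)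
    finally show ?thesis .
  qed
  then show ?thesis unfolding bounded_iff by blast
qed

lemma bounded_linear_diff0: "admissible G p f \<Longrightarrow> bounded_linear (diff0 f)"
  unfolding admissible_def by (blast intro: harmonic_map_has_derivative has_derivative_bounded_linear)

text \<open>At a unit vector maximizing \<open>|dF_0 v|\<close> the square splits over the
  components, and each term is at most the square of that component's own norm. Equality can fail
  because the components may be maximized in different directions.\<close>

lemma onorm_diff0_vec_le:
  fixes F :: "complex \<Rightarrow> 'a::euclidean_space ^ 'n::finite"
  assumes "admissible (prod_set G) p F"
  shows "(onorm (diff0 F))\<^sup>2 \<le> (\<Sum>j\<in>UNIV. (onorm (diff0 (\<lambda>z. F z $ j)))\<^sup>2)"
proof -
  obtain v where v: "norm v = 1" "norm (diff0 F v) = onorm (diff0 F)"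
    using onorm_attained[OF bounded_linear_diff0[OF assms]] .
  have "norm (diff0 (\<lambda>z. F z $ j) v) \<le> onorm (diff0 (\<lambda>z. F z $ j))" for j
    using assms v(1) onorm[OF bounded_linear_diff0, of "G j" "p $ j" "\<lambda>z. F z $ j" v]
    by (simp add: admissible_prod_set)
  moreover have "(onorm (diff0 F))\<^sup>2 = (\<Sum>j\<in>UNIV. (norm (diff0 (\<lambda>z. F z $ j) v))\<^sup>2)"
    using assms by (simp add: v(2)[symmetric] power2_norm_vec diff0_nth admissible_def)
  ultimately show ?thesis by (simp add: sum_mono power_mono)
qed

text \<open>For the lower bound, near-extremal maps into the factors are rotated so that each of them
  has \<open>1\<close> as a maximizing direction.\<close>

lemma M_prod_set:
  fixes G :: "'n::finite \<Rightarrow> 'a::euclidean_space set"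
  assumes "\<And>j. bounded (G j)" "admissible (prod_set G) p F"
  shows "(M (prod_set G) p)\<^sup>2 = (\<Sum>j\<in>UNIV. (M (G j) (p $ j))\<^sup>2)"
proof (rule antisym)
  \<comment> \<open>\<open>F\<close> itself is a competitor, which bounds \<open>M\<close> below by
    a norm. The sign is needed to square the upper bound.\<close>
  have M_nonneg: "0 \<le> M (prod_set G) p"
    using onorm_diff0_le_M[OF bounded_prod_set assms(2)] assms(1) onorm_pos_le[OF bounded_linear_diff0[OF assms(2)]]
    by fastforce
  have "onorm (diff0 f) \<le> sqrt (\<Sum>j\<in>UNIV. (M (G j) (p $ j))\<^sup>2)" if "admissible (prod_set G) p f" for f
  proof (rule real_le_rsqrt)
    note onorm_diff0_vec_le[OF that]
    also have "(\<Sum>j\<in>UNIV. (onorm (diff0 (\<lambda>z. f z $ j)))\<^sup>2) \<le> (\<Sum>j\<in>UNIV. (M (G j) (p $ j))\<^sup>2)"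
      using that assms(1)
      by (intro sum_mono power_mono onorm_diff0_le_M onorm_pos_le bounded_linear_diff0)
         (auto simp: admissible_prod_set)
    finally show "(onorm (diff0 f))\<^sup>2 \<le> (\<Sum>j\<in>UNIV. (M (G j) (p $ j))\<^sup>2)" .
  qed
  then have "M (prod_set G) p \<le> sqrt (\<Sum>j\<in>UNIV. (M (G j) (p $ j))\<^sup>2)"
    unfolding M_eq_Sup[of "prod_set G"] using assms(2) by (intro cSUP_least) auto
  then have "(M (prod_set G) p)\<^sup>2 \<le> (sqrt (\<Sum>j\<in>UNIV. (M (G j) (p $ j))\<^sup>2))\<^sup>2"
    using M_nonneg by (rule power_mono)
  then show "(M (prod_set G) p)\<^sup>2 \<le> (\<Sum>j\<in>UNIV. (M (G j) (p $ j))\<^sup>2)"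
    by (simp add: sum_nonneg)
  \<comment> \<open>No extremal map into a factor is assumed to exist, so each supremum is
    approached by a sequence of competitors; the components of \<open>F\<close> show that there are
    some.\<close>
  have "\<exists>f. (\<forall>n. admissible (G j) (p $ j) (f n)) \<and> (\<lambda>n. onorm (diff0 (f n))) \<longlonglongrightarrow> M (G j) (p $ j)" for j
  proof -
    let ?X = "(\<lambda>f. onorm (diff0 f)) ` Collect (admissible (G j) (p $ j))"
    have "?X \<noteq> {}" using assms(2) by (auto simp: admissible_prod_set)
    then have "M (G j) (p $ j) \<in> closure ?X"
      unfolding M_eq_Sup by (intro closure_contains_Sup bdd_above_onorm_diff0 assms(1))
    then obtain x where x: "\<And>n. x n \<in> ?X" "x \<longlonglongrightarrow> M (G j) (p $ j)"
      unfolding closure_sequential by blast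
    have "\<forall>n. \<exists>f. admissible (G j) (p $ j) f \<and> x n = onorm (diff0 f)"
      using x(1) by blast
    then obtain f where "\<And>n. admissible (G j) (p $ j) (f n)" "x = (\<lambda>n. onorm (diff0 (f n)))"
      by metis
    with x(2) show ?thesis by (intro exI[of _ f]) simp
  qed
  then obtain f where f: "\<And>j n. admissible (G j) (p $ j) (f j n)"
    "\<And>j. (\<lambda>n. onorm (diff0 (f j n))) \<longlonglongrightarrow> M (G j) (p $ j)"
    by metis
  have "(\<Sum>j\<in>UNIV. (onorm (diff0 (f j n)))\<^sup>2) \<le> (M (prod_set G) p)\<^sup>2" for n
  proof -
    have "\<forall>j. \<exists>v. norm v = 1 \<and> norm (diff0 (f j n) v) = onorm (diff0 (f j n))"
      using onorm_attained[OF bounded_linear_diff0[OF f(1)]] by metis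
    then obtain v where v: "\<And>j. norm (v j) = 1"
      "\<And>j. norm (diff0 (f j n) (v j)) = onorm (diff0 (f j n))"
      by metis
    \<comment> \<open>Each \<open>v j\<close> is a unit complex number, so multiplication by it is a
      rotation. All components of \<open>g\<close> are now maximized at 1, and
      \<open>|dg_0 1|\<close> collects their full norms.\<close>
    define g where "g z = (\<chi> j. f j n (v j * z))" for z
    have g: "admissible (prod_set G) p g"
      using admissible_rotate(1)[OF f(1) v(1)] by (simp add: admissible_prod_set g_def)
    have "(\<Sum>j\<in>UNIV. (onorm (diff0 (f j n)))\<^sup>2) = (norm (diff0 g 1))\<^sup>2"
    proof -
      have "diff0 g 1 $ j = diff0 (f j n) (v j)" for j
        using g admissible_rotate(2)[OF f(1) v(1)] by (simp add: admissible_def diff0_nth) (simp add: g_def)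
      then show ?thesis by (simp add: power2_norm_vec v(2))
    qed
    moreover have "norm (diff0 g 1) \<le> M (prod_set G) p"
      using onorm[OF bounded_linear_diff0[OF g], of 1] onorm_diff0_le_M[OF bounded_prod_set g] assms(1)
      by fastforce
    ultimately show ?thesis by (simp add: power_mono)
  qed
  moreover have "(\<lambda>n. \<Sum>j\<in>UNIV. (onorm (diff0 (f j n)))\<^sup>2) \<longlonglongrightarrow> (\<Sum>j\<in>UNIV. (M (G j) (p $ j))\<^sup>2)"
    by (intro tendsto_intros f(2))
  ultimately show "(\<Sum>j\<in>UNIV. (M (G j) (p $ j))\<^sup>2) \<le> (M (prod_set G) p)\<^sup>2"
    by (intro LIMSEQ_le_const2) auto
qed

section \<open>The equality case for a map into the product\<close>

theorem theorem7p2: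
  fixes K :: "'n::finite \<Rightarrow> 'k::finite set"
    and G :: "'n \<Rightarrow> (real ^ 'k) set"
    and p :: "(real ^ 'k) ^ 'n"
    and F :: "complex \<Rightarrow> (real ^ 'k) ^ 'n"
  assumes "\<And>j. bounded_domain_in (coord_space (K j)) (G j)"
    and "\<And>j. p $ j \<in> G j"
    and "harmonic_map F"
    and "F ` ball 0 1 \<subseteq> prod_set G"
    and "F 0 = p"
  shows "onorm (diff0 F) = M (prod_set G) p \<longleftrightarrow>
    (\<forall>j. onorm (diff0 (\<lambda>z. F z $ j)) = M (G j) (p $ j)) \<and>
    (\<exists>v::complex. norm v = 1 \<and>
       (\<forall>j. norm (diff0 (\<lambda>z. F z $ j) v) = onorm (diff0 (\<lambda>z. F z $ j))))"
proof -
  let ?f = "\<lambda>j z. F z $ j"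
  have bdd: "bounded (G j)" for j
    using assms(1) by (simp add: bounded_domain_in_def)
  have F: "admissible (prod_set G) p F"
    using assms(3-5) by (simp add: admissible_def)
  then have f: "admissible (G j) (p $ j) (?f j)" for j
    by (simp add: admissible_prod_set)
  have le_onorm: "norm (diff0 (?f j) v) \<le> onorm (diff0 (?f j))" if "norm v = 1" for j v
    using onorm[OF bounded_linear_diff0[OF f], of j v] that by simp
  have le_M: "onorm (diff0 (?f j)) \<le> M (G j) (p $ j)" for j
    by (rule onorm_diff0_le_M[OF bdd f])
  have norm_F: "(norm (diff0 F v))\<^sup>2 = (\<Sum>j\<in>UNIV. (norm (diff0 (?f j) v))\<^sup>2)" for v
    by (simp add: power2_norm_vec diff0_nth[OF assms(3)])
  note M_sq = M_prod_set[OF bdd F]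
  have le_M_F: "onorm (diff0 F) \<le> M (prod_set G) p"
    by (rule onorm_diff0_le_M[OF bounded_prod_set[OF bdd] F])
  show ?thesis
  proof (intro iffI conjI)
    assume eq: "onorm (diff0 F) = M (prod_set G) p"
    obtain v where v: "norm v = 1" "norm (diff0 F v) = onorm (diff0 F)"
      using onorm_attained[OF bounded_linear_diff0[OF F]] .
    \<comment> \<open>The maximizing vector \<open>v\<close> of \<open>dF_0\<close> is the candidate
      for the common direction. The two sums agree and are ordered term by term, so they agree term
      by term.\<close>
    have "(\<Sum>j\<in>UNIV. (norm (diff0 (?f j) v))\<^sup>2) = (\<Sum>j\<in>UNIV. (M (G j) (p $ j))\<^sup>2)"
      using norm_F[of v] v(2) eq M_sq by simp
    moreover have le: "(norm (diff0 (?f j) v))\<^sup>2 \<le> (M (G j) (p $ j))\<^sup>2" for j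
      using le_onorm[OF v(1), of j] le_M[of j] by (intro power_mono) auto
    ultimately have "(norm (diff0 (?f j) v))\<^sup>2 = (M (G j) (p $ j))\<^sup>2" for j
      using sum_mono_inv[of "\<lambda>j. (norm (diff0 (?f j) v))\<^sup>2" UNIV "\<lambda>j. (M (G j) (p $ j))\<^sup>2" j] by simp
    moreover have "0 \<le> M (G j) (p $ j)" for j
      using le_onorm[OF v(1), of j] le_M[of j] norm_ge_zero[of "diff0 (?f j) v"] by linarith
    ultimately have "norm (diff0 (?f j) v) = M (G j) (p $ j)" for j
      by simp
    \<comment> \<open>The ends of the chain \<open>norm (d(f_j)_0 v) \<le> onorm \<le> M\<close>
      coincide, which gives both conditions at once.\<close>
    then have *: "norm (diff0 (?f j) v) = onorm (diff0 (?f j))" "onorm (diff0 (?f j)) = M (G j) (p $ j)" for j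
      using le_onorm[OF v(1), of j] le_M[of j] by (auto intro: antisym)
    show "\<forall>j. onorm (diff0 (?f j)) = M (G j) (p $ j)" using * by blast
    show "\<exists>v::complex. norm v = 1 \<and> (\<forall>j. norm (diff0 (?f j) v) = onorm (diff0 (?f j)))"
      using * v(1) by blast
  next
    assume "(\<forall>j. onorm (diff0 (?f j)) = M (G j) (p $ j)) \<and>
      (\<exists>v::complex. norm v = 1 \<and> (\<forall>j. norm (diff0 (?f j) v) = onorm (diff0 (?f j))))"
    then obtain v where v: "norm v = 1" "\<And>j. norm (diff0 (?f j) v) = M (G j) (p $ j)"
      by auto
    \<comment> \<open>In the common direction every component contributes its full
      \<open>M (G j) (p $ j)\<close>, so \<open>|dF_0 v|\<close> already reaches the upper
      bound.\<close>
    have "(M (prod_set G) p)\<^sup>2 = (norm (diff0 F v))\<^sup>2"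
      by (simp add: M_sq norm_F v(2))
    then have "M (prod_set G) p \<le> norm (diff0 F v)"
      by (rule power2_le_imp_le[OF eq_refl norm_ge_zero])
    also have "\<dots> \<le> onorm (diff0 F)"
      using onorm[OF bounded_linear_diff0[OF F], of v] v(1) by simp
    finally show "onorm (diff0 F) = M (prod_set G) p"
      using le_M_F by simp
  qed
qed

end
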